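(* Let $h:\mathbb{R}^n\to\overline{\mathbb{R}}$ be a proper function and let $\overline{x}\in\arg\min_{\mathbb{R}^n}h$. Assume that $h$ is $(\kappa,\gamma)$-strongly quasar-convex with respect to $\overline{x}$, where $\kappa\in(0,1]$ and $\gamma>0$, and that $h$ is locally Lipschitz on $\mathrm{dom}(h)$. Then, for every $x\in\mathrm{dom}(h)$, $$\|x-\overline{x}\|\le\sqrt{\frac{2(2-\kappa)}{\kappa\gamma}}\,\sqrt{h(x)-h(\overline{x})},$$ and $$\|x-\overline{x}\|\le\frac{2}{\kappa\gamma}\,\mathrm{dist}\big(0,\partial^Ch(x)\big).$$
   Context: $\overline{\mathbb{R}}=\mathbb{R}\cup\{+\infty\}$; $\mathrm{dom}(h)=\{x:h(x)<+\infty\}$; $h$ is proper if $\mathrm{dom}(h)\neq\emptyset$; $\|\cdot\|$ is the Euclidean norm; $\mathrm{dist}(0,S)=\inf_{v\in S}\|v\|$. Locally Lipschitz on $\mathrm{dom}(h)$ means that every $x\in\mathrm{dom}(h)$ has an open neighborhood in $\mathbb{R}^n$ on which $h$ is (finite and) Lipschitz. Let $\kappa\in(0,1]$, $\gamma\ge 0$. A proper function $h:\mathbb{R}^n\to\overline{\mathbb{R}}$ with convex domain and $\arg\min_{\mathbb{R}^n}h\neq\emptyset$ is called $(\kappa,\gamma)$-strongly quasar-convex with respect to $\overline{x}\in\arg\min_{\mathbb{R}^n}h$ if for all $x\in\mathrm{dom}(h)$ and all $\lambda\in[0,1]$, $$h(\lambda\overline{x}+(1-\lambda)x)\le\kappa\lambda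 h(\overline{x})+(1-\kappa\lambda)h(x)-\lambda\left(1-\frac{\lambda}{2-\kappa}\right)\frac{\kappa\gamma}{2}\|x-\overline{x}\|^2.$$ The Clarke directional derivative is $h^\circ(x;d)=\limsup_{y\to x,\,t\downarrow 0}\frac{h(y+td)-h(y)}{t}$, and the Clarke subdifferential is $\partial^Ch(x)=\{v\in\mathbb{R}^n:\langle v,d\rangle\le h^\circ(x;d)\ \forall d\in\mathbb{R}^n\}$ for $x\in\mathrm{dom}(h)$, and $\partial^Ch(x)=\emptyset$ otherwise. *)

theory Defs
  imports "HOL-Analysis.Analysis"
begin

definition edom :: "('a \<Rightarrow> ereal) \<Rightarrow> 'a set" where
  "edom h = {x. h x < \<infinity>}"

text \<open>Functions with values in \<open>\<real> \<union> {+\<infinity>}\<close> are modelled as \<open>ereal\<close>-valued functions;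
  the first conjunct excludes the value \<open>-\<infinity>\<close>, which is not in that codomain.\<close>

definition proper :: "('a \<Rightarrow> ereal) \<Rightarrow> bool" where
  "proper h \<longleftrightarrow> (\<forall>x. h x \<noteq> -\<infinity>) \<and> edom h \<noteq> {}"

definition argmin :: "('a \<Rightarrow> ereal) \<Rightarrow> 'a set" where
  "argmin h = {x. is_arg_min h (\<lambda>_. True) x}"

text \<open>All function values on the right-hand side are finite for proper \<open>h\<close>, so the extended real
  arithmetic is ordinary real arithmetic there.\<close>

definition strongly_quasar_convex ::
    "real \<Rightarrow> real \<Rightarrow> ('a::euclidean_space \<Rightarrow> ereal) \<Rightarrow> 'a \<Rightarrow> bool" where
  "strongly_quasar_convex \<kappa> \<gamma> h xbar \<longleftrightarrow>
     0 < \<kappa> \<and> \<kappa> \<le> 1 \<and> 0 \<le> \<gamma> \<and>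
     proper h \<and> convex (edom h) \<and> xbar \<in> argmin h \<and>
     (\<forall>x\<in>edom h. \<forall>s\<in>{0..1}.
        h (s *\<^sub>R xbar + (1 - s) *\<^sub>R x)
          \<le> ereal (\<kappa> * s) * h xbar + ereal (1 - \<kappa> * s) * h x
             - ereal (s * (1 - s / (2 - \<kappa>)) * (\<kappa> * \<gamma> / 2) * (norm (x - xbar))\<^sup>2))"

definition locally_lipschitz_on_dom :: "('a::euclidean_space \<Rightarrow> ereal) \<Rightarrow> bool" where
  "locally_lipschitz_on_dom h \<longleftrightarrow>
     (\<forall>x\<in>edom h. \<exists>U L. open U \<and> x \<in> U \<and> (\<forall>y\<in>U. \<bar>h y\<bar> \<noteq> \<infinity>) \<and>
        L-lipschitz_on U (\<lambda>y. real_of_ereal (h y)))"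

text \<open>The filter \<open>nhds x\<close> (rather than \<open>at x\<close>) allows \<open>y = x\<close> in the upper limit,
  as usual for the Clarke derivative. The quotient is meaningful where \<open>h\<close> is finite
  near \<open>x\<close>.\<close>

definition clarke_dderiv :: "('a::euclidean_space \<Rightarrow> ereal) \<Rightarrow> 'a \<Rightarrow> 'a \<Rightarrow> ereal" where
  "clarke_dderiv h x d =
     Limsup (nhds x \<times>\<^sub>F at_right (0::real)) (\<lambda>(y, t). (h (y + t *\<^sub>R d) - h y) / ereal t)"

definition clarke_subdiff :: "('a::euclidean_space \<Rightarrow> ereal) \<Rightarrow> 'a \<Rightarrow> 'a set" where
  "clarke_subdiff h x =
     (if x \<in> edom h then {v. \<forall>d. ereal (v \<bullet> d) \<le> clarke_dderiv h x d} else {})"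

text \<open>Extended-real valued, so that the distance to the empty set is \<open>+\<infinity>\<close>
  (\<open>infdist\<close> would give 0).\<close>

definition dist_zero :: "'a::real_normed_vector set \<Rightarrow> ereal" where
  "dist_zero S = (INF v\<in>S. ereal (norm v))"

end

theory Submission
  imports Defs
begin

text \<open>Write \<open>D\<close> for the distance from \<open>x\<close> to the minimiser \<open>xbar\<close>.

  The quadratic growth bound is read off from the quasar-convexity inequality at a point
  \<open>s *\<^sub>R xbar + (1 - s) *\<^sub>R x\<close> of the segment, whose value is at least \<open>h xbar\<close>: dividing by
  \<open>1 - \<kappa> * s\<close> and letting \<open>s\<close> tend to \<open>1\<close> leaves exactly the constant \<open>\<kappa> * \<gamma> / (2 * (2 - \<kappa>))\<close>.
  The limit is needed only for \<open>\<kappa> = 1\<close>; for \<open>\<kappa> < 1\<close> one may put \<open>s = 1\<close>.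

  For the subdifferential bound, the Clarke derivative is taken in the direction \<open>xbar - x\<close>.
  Quasar-convexity at a nearby point \<open>y\<close> controls the difference quotient in the direction
  \<open>xbar - y\<close> instead, and the Lipschitz property makes the change of direction cost at most
  \<open>L * norm (y - x)\<close>, which vanishes as \<open>y\<close> tends to \<open>x\<close>.  Hence the Clarke derivative is at most
  \<open>- \<kappa> * (h x - h xbar) - \<kappa> * \<gamma> / 2 * D\<^sup>2\<close> (\<open>clarke_dderiv_le\<close>).  Every Clarke subgradient \<open>v\<close>
  then satisfies \<open>\<kappa> * \<gamma> / 2 * D\<^sup>2 \<le> v \<bullet> (x - xbar) \<le> norm v * D\<close>.\<close>

lemma proper_edom_ereal:
  assumes "proper h" "x \<in> edom h"
  shows "h x = ereal (real_of_ereal (h x))"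
  using assms by (cases "h x") (auto simp: proper_def edom_def)

lemma argmin_le: "xbar \<in> argmin h \<Longrightarrow> h xbar \<le> h x"
  for h :: "'a \<Rightarrow> ereal"
  by (auto simp: argmin_def is_arg_min_def not_less)

lemma argmin_in_edom:
  assumes "proper h" "xbar \<in> argmin h"
  shows "xbar \<in> edom h"
proof -
  obtain x where "x \<in> edom h"
    using assms(1) by (auto simp: proper_def)
  with argmin_le[OF assms(2), of x] show ?thesis
    by (auto simp: edom_def)
qed

text \<open>The defining inequality in ordinary real arithmetic: all three values of \<open>h\<close> are finite,
  since the domain is convex and contains \<open>xbar\<close>.\<close>

lemma strongly_quasar_convex_real:
  fixes h :: "'a::euclidean_space \<Rightarrow> ereal"
  defines "g \<equiv> \<lambda>x. real_of_ereal (h x)"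
  assumes qc: "strongly_quasar_convex \<kappa> \<gamma> h xbar"
    and x: "x \<in> edom h" and s: "0 \<le> s" "s \<le> 1"
  shows "g (s *\<^sub>R xbar + (1 - s) *\<^sub>R x) \<le> \<kappa> * s * g xbar + (1 - \<kappa> * s) * g x
           - s * (1 - s / (2 - \<kappa>)) * (\<kappa> * \<gamma> / 2) * (norm (x - xbar))\<^sup>2"
proof -
  let ?z = "s *\<^sub>R xbar + (1 - s) *\<^sub>R x"
  have p: "proper h" and c: "convex (edom h)" and a: "xbar \<in> argmin h"
    using qc by (auto simp: strongly_quasar_convex_def)
  have xb: "xbar \<in> edom h" by (rule argmin_in_edom[OF p a])
  have z: "?z \<in> edom h" using c xb x s by (auto simp: convex_def)
  have eqs: "h x = ereal (g x)" "h xbar = ereal (g xbar)" "h ?z = ereal (g ?z)"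
    unfolding g_def using proper_edom_ereal[OF p] x xb z by blast+
  have "h ?z \<le> ereal (\<kappa> * s) * h xbar + ereal (1 - \<kappa> * s) * h x
             - ereal (s * (1 - s / (2 - \<kappa>)) * (\<kappa> * \<gamma> / 2) * (norm (x - xbar))\<^sup>2)"
    using qc x s by (auto simp: strongly_quasar_convex_def)
  then show ?thesis unfolding eqs by simp
qed

lemma strongly_quasar_convex_quadratic_growth:
  fixes h :: "'a::euclidean_space \<Rightarrow> ereal"
  defines "g \<equiv> \<lambda>x. real_of_ereal (h x)"
  assumes qc: "strongly_quasar_convex \<kappa> \<gamma> h xbar" and x: "x \<in> edom h"
  shows "\<kappa> * \<gamma> / (2 * (2 - \<kappa>)) * (norm (x - xbar))\<^sup>2 \<le> g x - g xbar"
proof -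
  let ?D = "(norm (x - xbar))\<^sup>2"
  have p: "proper h" and c: "convex (edom h)" and a: "xbar \<in> argmin h"
    and k: "0 < \<kappa>" "\<kappa> \<le> 1"
    using qc by (auto simp: strongly_quasar_convex_def)
  have xb: "xbar \<in> edom h" by (rule argmin_in_edom[OF p a])
  have key: "s * (1 - s / (2 - \<kappa>)) * (\<kappa> * \<gamma> / 2) * ?D \<le> (1 - \<kappa> * s) * (g x - g xbar)"
    if s: "0 \<le> s" "s \<le> 1" for s
  proof -
    let ?z = "s *\<^sub>R xbar + (1 - s) *\<^sub>R x"
    have z: "?z \<in> edom h" using c xb x s by (auto simp: convex_def)
    have "ereal (g xbar) \<le> ereal (g ?z)"
      using argmin_le[OF a, of ?z] proper_edom_ereal[OF p xb] proper_edom_ereal[OF p z]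
      unfolding g_def by metis
    then have "g xbar \<le> g ?z" by simp
    also have "\<dots> \<le> \<kappa> * s * g xbar + (1 - \<kappa> * s) * g x
           - s * (1 - s / (2 - \<kappa>)) * (\<kappa> * \<gamma> / 2) * ?D"
      using strongly_quasar_convex_real[OF qc x s] unfolding g_def .
    finally show ?thesis by (simp add: algebra_simps)
  qed
  show ?thesis
  proof (cases "\<kappa> = 1")
    case True
    \<comment> \<open>Both sides of \<open>key\<close> vanish at \<open>s = 1\<close>, so the factor \<open>1 - s\<close> is cancelled before the limit.\<close>
    have "s * (\<gamma> / 2 * ?D) \<le> g x - g xbar" if s: "0 < s" "s < 1" for s
    proof -
      have "(1 - s) * (s * (\<gamma> / 2 * ?D)) \<le> (1 - s) * (g x - g xbar)"
        using key[of s] s True by (simp add: mult_ac)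
      then show ?thesis using s by (simp add: mult_le_cancel_left)
    qed
    then have "\<gamma> / 2 * ?D \<le> g x - g xbar"
      by (rule field_le_mult_one_interval)
    then show ?thesis using True by simp
  next
    case False
    have "1 - 1 / (2 - \<kappa>) = (1 - \<kappa>) / (2 - \<kappa>)"
      using k by (simp add: field_simps)
    then have "(1 - \<kappa>) * (\<kappa> * \<gamma> / (2 * (2 - \<kappa>)) * ?D) \<le> (1 - \<kappa>) * (g x - g xbar)"
      using key[of 1] by (simp add: mult_ac)
    then show ?thesis by (rule mult_left_le_imp_le) (use k False in simp)
  qed
qed

lemma clarke_dderiv_le:
  fixes h :: "'a::euclidean_space \<Rightarrow> ereal"
  defines "g \<equiv> \<lambda>x. real_of_ereal (h x)"
  assumes qc: "strongly_quasar_convex \<kappa> \<gamma> h xbar"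
    and lip: "locally_lipschitz_on_dom h" and x: "x \<in> edom h"
  shows "clarke_dderiv h x (xbar - x)
           \<le> ereal (- \<kappa> * (g x - g xbar) - \<kappa> * \<gamma> / 2 * (norm (x - xbar))\<^sup>2)"
proof -
  let ?F = "nhds x \<times>\<^sub>F at_right (0::real)"
  obtain U L where U: "open U" "x \<in> U" and fin: "\<And>y. y \<in> U \<Longrightarrow> \<bar>h y\<bar> \<noteq> \<infinity>"
    and L: "L-lipschitz_on U g"
    using lip[unfolded locally_lipschitz_on_dom_def, rule_format, OF x] unfolding g_def
    by (elim exE conjE) simp
  have U_ereal: "h y = ereal (g y)" if "y \<in> U" for y
    using fin[OF that] unfolding g_def by (simp add: ereal_real')
  have U_edom: "y \<in> edom h" if "y \<in> U" for y
    using U_ereal[OF that] by (simp add: edom_def)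
  have y_lim: "(fst \<longlongrightarrow> x) ?F"
    by (rule filterlim_fst)
  have t_lim_right: "filterlim snd (at_right 0) ?F"
    by (rule filterlim_snd)
  then have t_lim: "(snd \<longlongrightarrow> 0) ?F"
    by (rule filterlim_mono) (auto simp: at_within_le_nhds)
  have g_cont: "isCont g x"
    using lipschitz_on_continuous_on[OF L] U by (simp add: continuous_on_eq_continuous_at)
  have g_lim: "((\<lambda>p. g (fst p)) \<longlongrightarrow> g x) ?F"
    using isCont_tendsto_compose[OF g_cont y_lim] .
  let ?R = "\<lambda>p. \<kappa> * (g xbar - g (fst p))
      - (1 - snd p / (2 - \<kappa>)) * (\<kappa> * \<gamma> / 2) * (norm (fst p - xbar))\<^sup>2 + L * norm (fst p - x)"
  have k: "2 - \<kappa> \<noteq> 0" using qc by (auto simp: strongly_quasar_convex_def)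
  have "(?R \<longlongrightarrow> \<kappa> * (g xbar - g x)
      - (1 - 0 / (2 - \<kappa>)) * (\<kappa> * \<gamma> / 2) * (norm (x - xbar))\<^sup>2 + L * norm (x - x)) ?F"
    by (intro tendsto_intros y_lim t_lim g_lim k)
  then have R_lim: "(?R \<longlongrightarrow> - \<kappa> * (g x - g xbar) - \<kappa> * \<gamma> / 2 * (norm (x - xbar))\<^sup>2) ?F"
    by (simp add: algebra_simps)
  have "((\<lambda>p. fst p + snd p *\<^sub>R (xbar - x)) \<longlongrightarrow> x + 0 *\<^sub>R (xbar - x)) ?F"
    by (intro tendsto_intros y_lim t_lim)
  then have ev1: "\<forall>\<^sub>F p in ?F. fst p + snd p *\<^sub>R (xbar - x) \<in> U"
    using U by (intro topological_tendstoD[where S = U]) auto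
  have "((\<lambda>p. snd p *\<^sub>R xbar + (1 - snd p) *\<^sub>R fst p) \<longlongrightarrow> 0 *\<^sub>R xbar + (1 - 0) *\<^sub>R x) ?F"
    by (intro tendsto_intros y_lim t_lim)
  then have ev2: "\<forall>\<^sub>F p in ?F. snd p *\<^sub>R xbar + (1 - snd p) *\<^sub>R fst p \<in> U"
    using U by (intro topological_tendstoD[where S = U]) auto
  have ev3: "\<forall>\<^sub>F p in ?F. fst p \<in> U"
    using topological_tendstoD[OF y_lim U] .
  have ev4: "\<forall>\<^sub>F p in ?F. snd p \<in> {0<..<1}"
    using filterlim_iff[THEN iffD1, OF t_lim_right] eventually_at_right_real[of 0 1] by auto
  have "\<forall>\<^sub>F p in ?F. (case p of (y, t) \<Rightarrow> (h (y + t *\<^sub>R (xbar - x)) - h y) / ereal t) \<le> ereal (?R p)"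
    using ev1 ev2 ev3 ev4
  proof eventually_elim
    case (elim p)
    obtain y t where p: "p = (y, t)" by (cases p)
    let ?a = "y + t *\<^sub>R (xbar - x)" and ?b = "t *\<^sub>R xbar + (1 - t) *\<^sub>R y"
    have a: "?a \<in> U" and b: "?b \<in> U" and y: "y \<in> U" and t: "0 < t" "t < 1"
      using elim by (auto simp: p)
    \<comment> \<open>\<open>?b\<close> is reached from \<open>y\<close> in the direction \<open>xbar - y\<close>, \<open>?a\<close> in the direction \<open>xbar - x\<close>.\<close>
    have "?a - ?b = t *\<^sub>R (y - x)" by (simp add: algebra_simps)
    then have "dist ?a ?b = t * norm (y - x)" using t by (simp add: dist_norm)
    then have "dist (g ?a) (g ?b) \<le> L * (t * norm (y - x))"
      using lipschitz_onD[OF L a b] by simp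
    then have 1: "g ?a \<le> g ?b + L * (t * norm (y - x))"
      by (simp add: dist_real_def abs_le_iff)
    have 2: "g ?b \<le> \<kappa> * t * g xbar + (1 - \<kappa> * t) * g y
           - t * (1 - t / (2 - \<kappa>)) * (\<kappa> * \<gamma> / 2) * (norm (y - xbar))\<^sup>2"
      using strongly_quasar_convex_real[OF qc U_edom[OF y], of t] t unfolding g_def by simp
    define q where "q = (1 - t / (2 - \<kappa>)) * (\<kappa> * \<gamma> / 2) * (norm (y - xbar))\<^sup>2"
    have "g ?a - g y \<le> \<kappa> * t * g xbar + (1 - \<kappa> * t) * g y - t * q
        + L * (t * norm (y - x)) - g y"
      using 1 2 unfolding q_def by (simp only: mult.assoc)
    also have "\<dots> = (\<kappa> * (g xbar - g y) - q + L * norm (y - x)) * t"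
      by (simp add: algebra_simps)
    finally have "(g ?a - g y) / t \<le> ?R p"
      using t by (simp add: pos_divide_le_eq p q_def)
    then show ?case
      using t by (simp add: p U_ereal[OF a] U_ereal[OF y])
  qed
  then have "clarke_dderiv h x (xbar - x) \<le> Limsup ?F (\<lambda>p. ereal (?R p))"
    unfolding clarke_dderiv_def by (rule Limsup_mono)
  also have "\<dots> = ereal (- \<kappa> * (g x - g xbar) - \<kappa> * \<gamma> / 2 * (norm (x - xbar))\<^sup>2)"
    using R_lim by (intro lim_imp_Limsup) (auto simp: prod_filter_eq_bot)
  finally show ?thesis .
qed

lemma clarke_subgradient_norm_ge:
  fixes h :: "'a::euclidean_space \<Rightarrow> ereal"
  assumes qc: "strongly_quasar_convex \<kappa> \<gamma> h xbar" and \<gamma>: "0 < \<gamma>"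
    and lip: "locally_lipschitz_on_dom h" and v: "v \<in> clarke_subdiff h x"
  shows "norm (x - xbar) \<le> 2 / (\<kappa> * \<gamma>) * norm v"
proof (cases "x = xbar")
  case True
  then show ?thesis using qc \<gamma> by (auto simp: strongly_quasar_convex_def)
next
  case False
  let ?g = "\<lambda>x. real_of_ereal (h x)" and ?D = "norm (x - xbar)"
  have x: "x \<in> edom h"
    and v': "\<And>d. ereal (v \<bullet> d) \<le> clarke_dderiv h x d"
    using v by (auto simp: clarke_subdiff_def split: if_splits)
  have k: "0 < \<kappa>" "\<kappa> \<le> 1" using qc by (auto simp: strongly_quasar_convex_def)
  have "0 \<le> \<kappa> * \<gamma> / (2 * (2 - \<kappa>)) * ?D\<^sup>2" using k \<gamma> by simp
  also have "\<dots> \<le> ?g x - ?g xbar"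
    by (rule strongly_quasar_convex_quadratic_growth[OF qc x])
  finally have gap: "0 \<le> \<kappa> * (?g x - ?g xbar)" using k by simp
  have "ereal (v \<bullet> (xbar - x)) \<le> ereal (- \<kappa> * (?g x - ?g xbar) - \<kappa> * \<gamma> / 2 * ?D\<^sup>2)"
    using v' clarke_dderiv_le[OF qc lip x] by (rule order_trans)
  then have "\<kappa> * \<gamma> / 2 * ?D\<^sup>2 \<le> v \<bullet> (x - xbar)"
    using gap by (simp add: inner_diff_right)
  also have "\<dots> \<le> norm v * ?D" by (rule norm_cauchy_schwarz)
  finally have "(\<kappa> * \<gamma> / 2 * ?D) * ?D \<le> norm v * ?D" by (simp add: power2_eq_square mult_ac)
  then have "\<kappa> * \<gamma> / 2 * ?D \<le> norm v" using False by (simp add: mult_le_cancel_right)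
  then show ?thesis using k \<gamma> by (simp add: field_simps)
qed

theorem proposition37:
  fixes h :: "real ^ 'n \<Rightarrow> ereal" and xbar :: "real ^ 'n" and \<kappa> \<gamma> :: real
  assumes "proper h"
    and "xbar \<in> argmin h"
    and "0 < \<kappa>" and "\<kappa> \<le> 1" and "0 < \<gamma>"
    and "strongly_quasar_convex \<kappa> \<gamma> h xbar"
    and "locally_lipschitz_on_dom h"
  shows "\<forall>x\<in>edom h.
      norm (x - xbar) \<le> sqrt (2 * (2 - \<kappa>) / (\<kappa> * \<gamma>)) * sqrt (real_of_ereal (h x - h xbar)) \<and>
      ereal (norm (x - xbar)) \<le> ereal (2 / (\<kappa> * \<gamma>)) * dist_zero (clarke_subdiff h x)"
proof (intro ballI conjI)
  fix x assume x: "x \<in> edom h"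
  have xb: "xbar \<in> edom h" by (rule argmin_in_edom[OF assms(1,2)])
  let ?gap = "real_of_ereal (h x) - real_of_ereal (h xbar)"
  have gap: "real_of_ereal (h x - h xbar) = ?gap"
    by (subst proper_edom_ereal[OF assms(1) x], subst proper_edom_ereal[OF assms(1) xb]) simp
  have "(norm (x - xbar))\<^sup>2 \<le> 2 * (2 - \<kappa>) / (\<kappa> * \<gamma>) * ?gap"
    using strongly_quasar_convex_quadratic_growth[OF assms(6) x] assms(3-5)
    by (simp add: field_simps)
  then show "norm (x - xbar)
      \<le> sqrt (2 * (2 - \<kappa>) / (\<kappa> * \<gamma>)) * sqrt (real_of_ereal (h x - h xbar))"
    unfolding gap real_sqrt_mult[symmetric] by (rule real_le_rsqrt)
next
  fix x assume "x \<in> edom h"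
  have "ereal (\<kappa> * \<gamma> / 2 * norm (x - xbar)) \<le> dist_zero (clarke_subdiff h x)"
    unfolding dist_zero_def
  proof (rule INF_greatest)
    fix v assume "v \<in> clarke_subdiff h x"
    then have "norm (x - xbar) \<le> 2 / (\<kappa> * \<gamma>) * norm v"
      by (rule clarke_subgradient_norm_ge[OF assms(6,5,7)])
    then show "ereal (\<kappa> * \<gamma> / 2 * norm (x - xbar)) \<le> ereal (norm v)"
      using assms(3,5) by (simp add: field_simps)
  qed
  then have "ereal (2 / (\<kappa> * \<gamma>)) * ereal (\<kappa> * \<gamma> / 2 * norm (x - xbar))
      \<le> ereal (2 / (\<kappa> * \<gamma>)) * dist_zero (clarke_subdiff h x)"
    using assms(3,5) by (intro ereal_mult_left_mono) auto
  then show "ereal (norm (x - xbar)) \<le> ereal (2 / (\<kappa> * \<gamma>)) * dist_zero (clarke_subdiff h x)"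
    using assms(3,5) by simp
qed

end
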